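(* Let $n\ge1$ and $t\ge y\ge0$ be integers with $t\equiv y\pmod2$. Then $$\bar M^{(n)}_t(y;1)=1+\frac{n(y+2n+1)(t-y)}{(y+n)(t+y+4n)}.$$
   Context: A walk is a lattice path in $\mathbb Z^2$ with steps $(1,1)$ and $(1,-1)$ never going below the $x$-axis. A family of walks is vicious if no two of its walks share a lattice point. A contact is a lattice point on the $x$-axis lying on one of the walks (starting and end points included); $c(\mathbf P)$ is the total number of contacts of a family $\mathbf P$. $Z^{(n)}_t(y;\kappa)=\sum_{\mathbf P}\kappa^{c(\mathbf P)}$, summed over vicious families $(P_1,\dots,P_n)$ with $P_i$ running from $(0,2i-2)$ to $(t,y+2i-2)$. The normalized mean number of contacts is $\bar M^{(n)}_t(y;\kappa)=\kappa\frac{d}{d\kappa}Z^{(n)}_t(y;\kappa)\big/Z^{(n)}_t(y;\kappa)$. *)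

theory Defs
  imports "HOL-Analysis.Analysis"
begin

type_synonym point = "int \<times> int"

text \<open>A path is the list of the lattice points it visits, both end points included.\<close>

definition is_walk :: "point list \<Rightarrow> bool" where
  "is_walk p \<longleftrightarrow> p \<noteq> [] \<and> (\<forall>q\<in>set p. 0 \<le> snd q) \<and>
     (\<forall>j. Suc j < length p \<longrightarrow>
        (fst (p ! Suc j) - fst (p ! j), snd (p ! Suc j) - snd (p ! j)) \<in> {(1, 1), (1, -1)})"

definition runs_from_to :: "point list \<Rightarrow> point \<Rightarrow> point \<Rightarrow> bool" where
  "runs_from_to p a b \<longleftrightarrow> is_walk p \<and> hd p = a \<and> last p = b"

definition vicious :: "point list list \<Rightarrow> bool" where
  "vicious P \<longleftrightarrow>
     (\<forall>i j. i < length P \<longrightarrow> j < length P \<longrightarrow> i \<noteq> j \<longrightarrow> set (P ! i) \<inter> set (P ! j) = {})"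

text \<open>The list index runs over \<open>{0..<n}\<close>, so entry \<open>i\<close> is the walk
  \<open>P\<^sub>i\<^sub>+\<^sub>1\<close>, whose end points are raised by \<open>2 (i + 1) - 2 = 2 i\<close>.\<close>

definition vicious_families :: "nat \<Rightarrow> nat \<Rightarrow> nat \<Rightarrow> point list list set" where
  "vicious_families n t y =
     {P. length P = n \<and> vicious P \<and>
         (\<forall>i<n. runs_from_to (P ! i) (0, 2 * int i) (int t, int y + 2 * int i))}"

definition contacts :: "point list list \<Rightarrow> nat" where
  "contacts P = card {q. snd q = 0 \<and> (\<exists>p\<in>set P. q \<in> set p)}"

definition Z :: "nat \<Rightarrow> nat \<Rightarrow> nat \<Rightarrow> real \<Rightarrow> real" where
  "Z n t y \<kappa> = (\<Sum>P\<in>vicious_families n t y. \<kappa> ^ contacts P)"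

definition mean_contacts :: "nat \<Rightarrow> nat \<Rightarrow> nat \<Rightarrow> real \<Rightarrow> real" where
  "mean_contacts n t y \<kappa> = \<kappa> * deriv (Z n t y) \<kappa> / Z n t y \<kappa>"

text \<open>The set of families is finite, so the sum in \<open>Z\<close> is not the default value
  of a sum over an infinite set.\<close>

lemma walk_fst_nth:
  assumes "is_walk p" and "j < length p"
  shows "fst (p ! j) = fst (hd p) + int j"
  using assms(2)
proof (induction j)
  case 0
  then show ?case by (simp add: hd_conv_nth)
next
  case (Suc j)
  then have "fst (p ! Suc j) - fst (p ! j) = 1"
    using assms(1) unfolding is_walk_def by blast
  with Suc show ?case by simp
qed

lemma walk_snd_nth:
  assumes "is_walk p" and "j < length p"
  shows "snd (p ! j) \<le> snd (hd p) + int j"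
  using assms(2)
proof (induction j)
  case 0
  then show ?case by (simp add: hd_conv_nth)
next
  case (Suc j)
  then have "snd (p ! Suc j) - snd (p ! j) \<in> {1, -1}"
    using assms(1) unfolding is_walk_def by blast
  with Suc show ?case by auto
qed

lemma finite_walks: "finite {p. runs_from_to p a b}"
proof (rule finite_subset)
  define m where "m = nat (fst b - fst a) + 1"
  let ?Q = "{fst a..fst a + int m} \<times> {0..snd a + int m}"
  show "finite {p. set p \<subseteq> ?Q \<and> length p \<le> m}"
    by (rule finite_lists_length_le) simp
  show "{p. runs_from_to p a b} \<subseteq> {p. set p \<subseteq> ?Q \<and> length p \<le> m}"
  proof
    fix p assume "p \<in> {p. runs_from_to p a b}"
    then have w: "is_walk p" and h: "hd p = a" and l: "last p = b"
      by (auto simp: runs_from_to_def)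
    then have ne: "p \<noteq> []" by (simp add: is_walk_def)
    then have "fst b = fst a + int (length p - 1)"
      using walk_fst_nth[OF w, of "length p - 1"] h l by (simp add: last_conv_nth)
    with ne have len: "length p = m"
      by (cases p) (auto simp: m_def)
    have "q \<in> ?Q" if "q \<in> set p" for q
    proof -
      from that obtain j where j: "j < length p" "p ! j = q"
        by (auto simp: in_set_conv_nth)
      have "0 \<le> snd q" using w that by (auto simp: is_walk_def)
      then show ?thesis
        using walk_fst_nth[OF w j(1)] walk_snd_nth[OF w j(1)] j h len
        by (simp add: mem_Times_iff)
    qed
    with len show "p \<in> {p. set p \<subseteq> ?Q \<and> length p \<le> m}" by blast
  qed
qed

lemma finite_vicious_families: "finite (vicious_families n t y)"
proof (rule finite_subset)
  let ?W = "\<Union>i<n. {p. runs_from_to p (0, 2 * int i) (int t, int y + 2 * int i)}"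
  show "finite {P. set P \<subseteq> ?W \<and> length P = n}"
    by (rule finite_lists_length_eq) (simp add: finite_walks)
  show "vicious_families n t y \<subseteq> {P. set P \<subseteq> ?W \<and> length P = n}"
    by (fastforce simp: vicious_families_def in_set_conv_nth)
qed

end

theory Submission
  imports Defs "Jordan_Normal_Form.Determinant"
begin

text \<open>
  Up to a constant factor, the number of vicious families ending at heights
  \<open>x\<^sub>1 < \<dots> < x\<^sub>n\<close> at time \<open>t\<close> is a product \<open>N\<^sub>t(x)\<close> of a weight for each \<open>x\<^sub>j\<close> and the
  Vandermonde determinant of the \<open>(x\<^sub>j + 1)\<^sup>2\<close>. Indeed, by multilinearity of the determinant,
  summing \<open>N\<^sub>t\<close> over all \<open>2\<^sup>n\<close> last steps applies to each row an operator that is triangular on odd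
  polynomials in \<open>x\<^sub>j + 1\<close>, and \<open>N\<^sub>t\<close> vanishes when two heights coincide or one is \<open>-1\<close>.

  The total number of contacts, up to the same factor, is
  \<open>R\<^sub>t(x) = N\<^sub>t(x) + \<Sum>\<^sub>k N\<^sub>t(x + 2 e\<^sub>k)\<close>. This satisfies the same free recursion; it vanishes
  at coincident heights by antisymmetry, and its value \<open>N\<^sub>t(1, x\<^sub>2, \<dots>)\<close> at
  \<open>x\<^sub>1 = -1\<close> accounts for the contacts of the last step. For \<open>x\<^sub>j = y + 2 j - 2\<close> only the summand
  \<open>k = n\<close> survives, so the mean number of contacts is \<open>1 + N\<^sub>t(x + 2 e\<^sub>n) / N\<^sub>t(x)\<close>.
\<close>

section \<open>Determinants\<close>

abbreviation matrix_det :: "nat \<Rightarrow> (nat \<Rightarrow> nat \<Rightarrow> real) \<Rightarrow> real" where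
  "matrix_det n f \<equiv> Determinant.det (Matrix.mat n n (\<lambda>(j, i). f j i))"

lemma matrix_det_leibniz:
  "matrix_det n f = (\<Sum>p\<in>{p. p permutes {..<n}}. signof p * (\<Prod>j<n. f j (p j)))"
proof -
  have "p j < n" if "p permutes {0..<n}" "j < n" for p j
    using permutes_in_image[OF that(1), of j] that(2) by simp
  then show ?thesis
    by (subst Determinant.det_def'[where n = n])
       (auto simp: atLeast0LessThan intro!: sum.cong prod.cong)
qed

text \<open>Multilinearity in all rows at once: \<open>S\<close> records the rows in which the
  summand \<open>f\<close> is chosen. Later \<open>S\<close> is the set of walks whose last step
  goes up.\<close>

lemma matrix_det_add:
  "matrix_det n (\<lambda>j i. f j i + g j i) =
     (\<Sum>S\<in>Pow {..<n}. matrix_det n (\<lambda>j i. if j \<in> S then f j i else g j i))"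
proof -
  have split: "(\<Prod>j<n. if j \<in> S then f j (p j) else g j (p j)) =
      (\<Prod>j\<in>S. f j (p j)) * (\<Prod>j\<in>{..<n} - S. g j (p j))" if "S \<in> Pow {..<n}" for S p
  proof -
    have "{..<n} \<inter> {j. j \<in> S} = S" "{..<n} \<inter> - {j. j \<in> S} = {..<n} - S"
      using that by auto
    then show ?thesis
      by (simp add: prod.If_cases)
  qed
  have "matrix_det n (\<lambda>j i. f j i + g j i) = (\<Sum>p\<in>{p. p permutes {..<n}}. \<Sum>S\<in>Pow {..<n}.
      signof p * (\<Prod>j<n. if j \<in> S then f j (p j) else g j (p j)))"
    unfolding matrix_det_leibniz by (simp add: prod_add split sum_distrib_left)
  also have "\<dots> = (\<Sum>S\<in>Pow {..<n}. \<Sum>p\<in>{p. p permutes {..<n}}.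
      signof p * (\<Prod>j<n. if j \<in> S then f j (p j) else g j (p j)))"
    by (rule sum.swap)
  finally show ?thesis
    unfolding matrix_det_leibniz .
qed

lemma matrix_det_scale_rows:
  "matrix_det n (\<lambda>j i. w j * f j i) = (\<Prod>j<n. w j) * matrix_det n f"
  unfolding matrix_det_leibniz by (simp add: prod.distrib sum_distrib_left mult_ac)

text \<open>The matrix is the product of the matrix of powers and the matrix of coefficients; the
  degree bound makes the latter upper triangular.\<close>

lemma matrix_det_poly:
  assumes "\<And>i. i < n \<Longrightarrow> degree (q i) \<le> i"
  shows "matrix_det n (\<lambda>j i. poly (q i) (v j)) =
    (\<Prod>i<n. coeff (q i) i) * matrix_det n (\<lambda>j i. v j ^ i)"
proof -
  let ?V = "Matrix.mat n n (\<lambda>(j, i). v j ^ i)"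
  let ?C = "Matrix.mat n n (\<lambda>(k, i). coeff (q i) k)"
  have expand: "poly (q i) x = (\<Sum>k<n. x ^ k * coeff (q i) k)" if "i < n" for i x
  proof -
    have "(\<Sum>k\<le>degree (q i). coeff (q i) k * x ^ k) = (\<Sum>k<n. coeff (q i) k * x ^ k)"
      using assms[OF that] that
      by (intro sum.mono_neutral_left) (auto simp: coeff_eq_0)
    then show ?thesis
      by (simp add: poly_altdef mult.commute)
  qed
  have "Matrix.mat n n (\<lambda>(j, i). poly (q i) (v j)) = ?V * ?C"
    by (rule eq_matI) (auto simp: scalar_prod_def expand atLeast0LessThan)
  moreover have "Determinant.det ?C = (\<Prod>i<n. coeff (q i) i)"
  proof -
    have "upper_triangular ?C"
      unfolding upper_triangular_def
    proof (intro allI impI)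
      fix i j assume "i < dim_row ?C" "j < i"
      with assms[of j] show "?C $$ (i, j) = 0"
        by (auto intro: coeff_eq_0)
    qed
    then have "Determinant.det ?C = prod_list (diag_mat ?C)"
      by (rule det_upper_triangular) auto
    also have "diag_mat ?C = map (\<lambda>i. coeff (q i) i) [0..<n]"
      by (auto simp: diag_mat_def)
    finally show ?thesis
      by (simp add: prod.list_conv_set_nth atLeast0LessThan)
  qed
  ultimately show ?thesis
    by (simp add: Determinant.det_mult[where n = n] mult.commute)
qed

text \<open>The Newton basis \<open>q i\<close> is monic of degree \<open>i\<close>, so passing to
  it keeps the determinant; as \<open>q i\<close> vanishes at \<open>v j\<close> for
  \<open>j < i\<close>, the new matrix is lower triangular.\<close>

lemma vandermonde:
  "matrix_det n (\<lambda>j i. v j ^ i) = (\<Prod>j<n. \<Prod>i<j. v j - v i)"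
proof -
  define q where "q = (\<lambda>i. \<Prod>k<i. [:- v k, 1:])"
  have deg: "degree (q i) = i" for i
    unfolding q_def by (subst degree_prod_eq_sum_degree) auto
  have lead: "coeff (q i) i = 1" for i
    using lead_coeff_prod[of "\<lambda>k. [:- v k, 1:]" "{..<i}"] deg[of i] by (simp add: q_def)
  have ev: "poly (q i) x = (\<Prod>k<i. x - v k)" for i x
    by (simp add: q_def poly_prod)
  let ?Q = "Matrix.mat n n (\<lambda>(j, i). poly (q i) (v j))"
  have "Determinant.det ?Q = prod_list (diag_mat ?Q)"
    by (rule Determinant.det_lower_triangular[where n = n]) (auto simp: ev)
  also have "diag_mat ?Q = map (\<lambda>j. poly (q j) (v j)) [0..<n]"
    by (auto simp: diag_mat_def)
  finally have "Determinant.det ?Q = (\<Prod>j<n. \<Prod>i<j. v j - v i)"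
    by (simp add: ev prod.list_conv_set_nth atLeast0LessThan)
  moreover have "Determinant.det ?Q = matrix_det n (\<lambda>j i. v j ^ i)"
    using matrix_det_poly[of n q v] deg lead by simp
  ultimately show ?thesis by simp
qed

lemma vandermonde_swap:
  assumes "k < n" "l < n" "k \<noteq> l"
  shows "matrix_det n (\<lambda>j i. (v \<circ> Transposition.transpose k l) j ^ i) = - matrix_det n (\<lambda>j i. v j ^ i)"
proof -
  have "Matrix.mat n n (\<lambda>(j, i). (v \<circ> Transposition.transpose k l) j ^ i) =
      swaprows k l (Matrix.mat n n (\<lambda>(j, i). v j ^ i))"
    using assms by (intro eq_matI) (auto simp: Transposition.transpose_def)
  then show ?thesis
    using det_swaprows[OF assms, of "Matrix.mat n n (\<lambda>(j, i). v j ^ i)"] by simp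
qed

text \<open>The even part of \<open>(u + 1) ^ (2 * i + 1)\<close> in \<open>u\<close>, and its odd part divided by \<open>u\<close>, both as
  polynomials in \<open>u\<^sup>2\<close>.\<close>

fun even_part odd_part :: "nat \<Rightarrow> real poly" where
  "odd_part 0 = 1"
| "odd_part (Suc i) = [:1, 1:] * odd_part i + [:2:] * even_part i"
| "even_part 0 = 1"
| "even_part (Suc i) = [:1, 1:] * even_part i + [:0, 2:] * odd_part i"

text \<open>As the exponent is odd, replacing \<open>u\<close> by \<open>- u\<close> turns
  \<open>(u + 1) ^ (2 * i + 1)\<close> into \<open>- (u - 1) ^ (2 * i + 1)\<close>. In the induction
  step, multiplying by \<open>(u + 1)\<^sup>2\<close> means that \<open>1 + u\<^sup>2\<close>
  preserves the two parts and \<open>2 * u\<close> exchanges them.\<close>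

lemma parts:
  "u * poly (odd_part i) (u\<^sup>2) = ((u + 1) ^ (2 * i + 1) + (u - 1) ^ (2 * i + 1)) / 2"
  "poly (even_part i) (u\<^sup>2) = ((u + 1) ^ (2 * i + 1) - (u - 1) ^ (2 * i + 1)) / 2"
proof (induction i)
  case (Suc i)
  {
    case 1
    have "u * poly (odd_part (Suc i)) (u\<^sup>2) =
        (1 + u\<^sup>2) * (u * poly (odd_part i) (u\<^sup>2)) + 2 * u * poly (even_part i) (u\<^sup>2)"
      by (simp add: algebra_simps)
    also have "\<dots> = ((u + 1) ^ (2 * Suc i + 1) + (u - 1) ^ (2 * Suc i + 1)) / 2"
      unfolding Suc.IH by (simp add: field_simps power2_eq_square)
    finally show ?case .
  next
    case 2
    have "poly (even_part (Suc i)) (u\<^sup>2) =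
        (1 + u\<^sup>2) * poly (even_part i) (u\<^sup>2) + 2 * u * (u * poly (odd_part i) (u\<^sup>2))"
      by (simp add: algebra_simps power2_eq_square)
    also have "\<dots> = ((u + 1) ^ (2 * Suc i + 1) - (u - 1) ^ (2 * Suc i + 1)) / 2"
      unfolding Suc.IH by (simp add: field_simps power2_eq_square)
    finally show ?case .
  }
qed simp_all

lemma degree_parts: "degree (odd_part i) \<le> i \<and> degree (even_part i) \<le> i"
proof (induction i)
  case (Suc i)
  have "degree ([:1, 1:] * odd_part i) \<le> Suc i" "degree ([:2:] * even_part i) \<le> Suc i"
    "degree ([:1, 1:] * even_part i) \<le> Suc i" "degree ([:0, 2:] * odd_part i) \<le> Suc i"
    using Suc by (auto intro!: order.trans[OF degree_mult_le] simp del: mult_pCons_left)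
  then show ?case
    by (simp only: even_part.simps odd_part.simps degree_add_le)
qed simp

lemma coeff_parts: "coeff (odd_part i) i = 1 \<and> coeff (even_part i) i = 2 * real i + 1"
proof (induction i)
  case (Suc i)
  have "coeff (odd_part i) (Suc i) = 0" "coeff (even_part i) (Suc i) = 0"
    using degree_parts[of i] by (auto intro!: coeff_eq_0)
  with Suc show ?case by simp
qed simp

text \<open>Each entry is \<open>s\<close> times the odd part minus \<open>u j\<close> times the
  even part of \<open>(u j + 1) ^ (2 * i + 1)\<close>. This is \<open>u j\<close> times a polynomial
  in \<open>(u j)\<^sup>2\<close> of degree at most \<open>i\<close>, so
  \<open>matrix_det_poly\<close> applies.\<close>

lemma shifted_det:
  "matrix_det n (\<lambda>j i. (s + u j) / 2 * (u j - 1) ^ (2 * i + 1) + (s - u j) / 2 * (u j + 1) ^ (2 * i + 1)) =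
    (\<Prod>i<n. s - (2 * real i + 1)) * (\<Prod>j<n. u j) * matrix_det n (\<lambda>j i. ((u j)\<^sup>2) ^ i)"
proof -
  define q where "q = (\<lambda>i. [:s:] * odd_part i - even_part i)"
  have row: "(s + x) / 2 * (x - 1) ^ (2 * i + 1) + (s - x) / 2 * (x + 1) ^ (2 * i + 1) =
      x * poly (q i) (x\<^sup>2)" for x i
  proof -
    have "x * poly (q i) (x\<^sup>2) = s * (x * poly (odd_part i) (x\<^sup>2)) - x * poly (even_part i) (x\<^sup>2)"
      by (simp add: q_def algebra_simps)
    then show ?thesis
      unfolding parts by (simp add: field_simps)
  qed
  have "degree (q i) \<le> i" for i
    using degree_parts[of i] unfolding q_def by (intro degree_diff_le) auto
  moreover have "coeff (q i) i = s - (2 * real i + 1)" for i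
    using coeff_parts[of i] by (simp add: q_def)
  ultimately show ?thesis
    unfolding row matrix_det_scale_rows by (simp add: matrix_det_poly)
qed

lemma matrix_det_cong:
  assumes "\<And>j i. j < n \<Longrightarrow> i < n \<Longrightarrow> f j i = g j i"
  shows "matrix_det n f = matrix_det n g"
proof -
  have "Matrix.mat n n (\<lambda>(j, i). f j i) = Matrix.mat n n (\<lambda>(j, i). g j i)"
    using assms by (intro eq_matI) auto
  then show ?thesis by simp
qed

section \<open>The product formula and its recursion\<close>

text \<open>\<open>1 / \<Gamma>(k + 1)\<close>, which vanishes at the negative integers.\<close>

definition inv_fact :: "int \<Rightarrow> real" where
  "inv_fact k = (if k < 0 then 0 else 1 / fact (nat k))"

text \<open>At \<open>k = 0\<close> the factor \<open>k\<close> vanishes and for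
  \<open>k < 0\<close> both values of \<open>inv_fact\<close> do, so the recursion of the weights
  has no boundary cases.\<close>

lemma inv_fact_pred: "inv_fact (k - 1) = of_int k * inv_fact k"
proof (cases "k \<le> 0")
  case False
  then have "nat k = Suc (nat (k - 1))" by simp
  then show ?thesis
    using False by (simp add: inv_fact_def field_simps)
qed (auto simp: inv_fact_def)

text \<open>For \<open>n \<ge> 1\<close> and \<open>t + x\<close> even this is the binomial
  coefficient of \<open>t + 2 * n - 1\<close> over \<open>(t + x) / 2 + n\<close>, divided by
  \<open>fact (t + 2 * n - 1)\<close>.\<close>

definition weight :: "nat \<Rightarrow> nat \<Rightarrow> int \<Rightarrow> real" where
  "weight n t x = inv_fact ((int t + x) div 2 + int n) * inv_fact ((int t - x) div 2 + int n - 1)"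

text \<open>With \<open>s = t + 2 * n\<close> and \<open>u = x + 1\<close> the factor is
  \<open>(s + u) / 2\<close>, as \<open>shifted_det\<close> expects; an increase of the height gives
  \<open>(s - u) / 2\<close> instead.\<close>

lemma weight_pred:
  assumes "even (int t + x + 1)"
  shows "weight n t (x - 1) = (real t + 2 * real n + (real_of_int x + 1)) / 2 * weight n (Suc t) x"
proof -
  obtain k where k: "int t + x + 1 = 2 * k" using assms by blast
  then have x: "x = 2 * k - int t - 1" by simp
  have "(int t + (x - 1)) div 2 = k - 1" "(int (Suc t) + x) div 2 = k"
    "(int t - (x - 1)) div 2 = int t + 1 - k" "(int (Suc t) - x) div 2 = int t + 1 - k"
    by (simp_all add: x)
  moreover have "inv_fact (k - 1 + int n) = of_int (k + int n) * inv_fact (k + int n)"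
    using inv_fact_pred[of "k + int n"] by (simp add: algebra_simps)
  ultimately show ?thesis
    by (simp add: weight_def x field_simps)
qed

lemma weight_succ:
  assumes "even (int t + x + 1)"
  shows "weight n t (x + 1) = (real t + 2 * real n - (real_of_int x + 1)) / 2 * weight n (Suc t) x"
proof -
  obtain k where k: "int t + x + 1 = 2 * k" using assms by blast
  then have x: "x = 2 * k - int t - 1" by simp
  define m where "m = int t + int n - k"
  have "(int t + (x + 1)) div 2 = k" "(int (Suc t) + x) div 2 = k"
    "(int t - (x + 1)) div 2 + int n - 1 = m - 1" "(int (Suc t) - x) div 2 + int n - 1 = m"
    by (simp_all add: x m_def)
  then have "weight n t (x + 1) = inv_fact (k + int n) * inv_fact (m - 1)"
    "weight n (Suc t) x = inv_fact (k + int n) * inv_fact m"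
    by (simp_all add: weight_def)
  moreover have "(real t + 2 * real n - (real_of_int x + 1)) / 2 = of_int m"
    by (simp add: x m_def)
  ultimately show ?thesis
    by (simp add: inv_fact_pred)
qed

text \<open>The heights one step earlier, when exactly the walks in \<open>S\<close> arrive by an
  up-step.\<close>

definition moves :: "nat set \<Rightarrow> (nat \<Rightarrow> int) \<Rightarrow> nat \<Rightarrow> int" where
  "moves S x i = (if i \<in> S then x i - 1 else x i + 1)"

text \<open>Collects the constants that \<open>shifted_det\<close> produces at each time step, so
  that the recursion of \<open>star\<close> carries no factor.\<close>

definition norm_const :: "nat \<Rightarrow> nat \<Rightarrow> real" where
  "norm_const n t = (\<Prod>s<t. \<Prod>i<n. real s + 2 * real n - (2 * real i + 1))"

text \<open>Up to a constant factor, the number of vicious families ending at the heights \<open>x\<close>,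
  extended to all integer arguments as an antisymmetric function that is odd in each \<open>x j + 1\<close>.\<close>

definition star :: "nat \<Rightarrow> nat \<Rightarrow> (nat \<Rightarrow> int) \<Rightarrow> real" where
  "star n t x = norm_const n t * (\<Prod>j<n. (of_int (x j) + 1) * weight n t (x j)) *
     matrix_det n (\<lambda>j i. ((of_int (x j) + 1)\<^sup>2) ^ i)"

lemma star_Suc:
  assumes "\<And>j. j < n \<Longrightarrow> even (int t + x j + 1)"
  shows "star n (Suc t) x = (\<Sum>S\<in>Pow {..<n}. star n t (moves S x))"
proof -
  define s where "s = real t + 2 * real n"
  define u where "u = (\<lambda>j. real_of_int (x j) + 1)"
  define w where "w = (\<lambda>j. weight n (Suc t) (x j))"
  define f where "f = (\<lambda>j i. w j * ((s + u j) / 2 * (u j - 1) ^ (2 * i + 1)))"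
  define g where "g = (\<lambda>j i. w j * ((s - u j) / 2 * (u j + 1) ^ (2 * i + 1)))"
  \<comment> \<open>Row \<open>j\<close> absorbs its weight and its factor
    \<open>of_int (x j) + 1\<close>; the latter turns the even powers into odd ones.\<close>
  have term_eq: "star n t (moves S x) =
      norm_const n t * matrix_det n (\<lambda>j i. if j \<in> S then f j i else g j i)" for S
    unfolding star_def mult.assoc matrix_det_scale_rows[symmetric]
    using assms
    by (intro arg_cong2[where f = "(*)"] refl matrix_det_cong)
       (simp add: moves_def f_def g_def w_def u_def s_def weight_pred weight_succ power_mult)
  have "(\<Sum>S\<in>Pow {..<n}. star n t (moves S x)) = norm_const n t * matrix_det n (\<lambda>j i. f j i + g j i)"
    unfolding term_eq matrix_det_add by (simp add: sum_distrib_left)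
  also have "matrix_det n (\<lambda>j i. f j i + g j i) = (\<Prod>j<n. w j) * ((\<Prod>i<n. s - (2 * real i + 1)) *
      (\<Prod>j<n. u j) * matrix_det n (\<lambda>j i. ((u j)\<^sup>2) ^ i))"
    unfolding f_def g_def distrib_left[symmetric] matrix_det_scale_rows shifted_det ..
  finally show ?thesis
    by (simp add: star_def norm_const_def w_def u_def s_def prod.distrib mult_ac)
qed

lemma norm_const_pos: "norm_const n t > 0"
  unfolding norm_const_def
proof (intro prod_pos ballI)
  fix s i assume "i \<in> {..<n}"
  then have "2 * real i + 2 \<le> 2 * real n" by (simp flip: of_nat_Suc)
  then show "0 < real s + 2 * real n - (2 * real i + 1)" by linarith
qed

lemma star_eq_0_axis:
  assumes "j < n" "x j = -1"
  shows "star n t x = 0"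
proof -
  have "(\<Prod>j<n. (of_int (x j) + 1) * weight n t (x j)) = 0"
    using assms by (intro prod_zero) (auto intro!: bexI[of _ j])
  then show ?thesis
    by (simp add: star_def)
qed

lemma star_eq_0_coincide:
  assumes "i < n" "j < n" "i \<noteq> j" "x i = x j"
  shows "star n t x = 0"
proof -
  have "\<exists>i j. i < j \<and> j < n \<and> x i = x j"
    using assms by (metis nat_neq_iff)
  then obtain a b where "a < b" "b < n" "x a = x b" by blast
  then have "(\<Prod>j<n. \<Prod>i<j. (real_of_int (x j) + 1)\<^sup>2 - (real_of_int (x i) + 1)\<^sup>2) = 0"
    by (intro prod_zero bexI[of _ b] bexI[of _ a]) auto
  then show ?thesis
    unfolding star_def vandermonde by simp
qed

lemma star_swap:
  assumes "k < n" "l < n" "k \<noteq> l"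
  shows "star n t (x \<circ> Transposition.transpose k l) = - star n t x"
proof -
  define h where "h = (\<lambda>j. (real_of_int (x j) + 1) * weight n t (x j))"
  have h: "prod (h \<circ> Transposition.transpose k l) {..<n} = prod h {..<n}"
    using assms by (intro prod.permute[symmetric] permutes_swap_id) auto
  show ?thesis
    using vandermonde_swap[OF assms, of "\<lambda>j. (of_int (x j) + 1)\<^sup>2"] h
    unfolding star_def h_def o_def by (simp only: mult_minus_right)
qed

section \<open>Recursion for vicious families\<close>

text \<open>Arbitrary end heights are allowed because removing the last points leads away from the
  equally spaced heights of the theorem.\<close>

definition families :: "nat \<Rightarrow> nat \<Rightarrow> (nat \<Rightarrow> int) \<Rightarrow> point list list set" where
  "families n t x = {P. length P = n \<and> vicious P \<and>
     (\<forall>i<n. runs_from_to (P ! i) (0, 2 * int i) (int t, x i))}"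

lemma finite_families: "finite (families n t x)"
proof (rule finite_subset)
  let ?W = "\<Union>i<n. {p. runs_from_to p (0, 2 * int i) (int t, x i)}"
  show "finite {P. set P \<subseteq> ?W \<and> length P = n}"
    by (rule finite_lists_length_eq) (simp add: finite_walks)
  show "families n t x \<subseteq> {P. set P \<subseteq> ?W \<and> length P = n}"
    by (fastforce simp: families_def in_set_conv_nth)
qed

lemma is_walk_snoc:
  assumes "q \<noteq> []"
  shows "is_walk (q @ [z]) \<longleftrightarrow> is_walk q \<and> 0 \<le> snd z \<and>
    (fst z - fst (last q), snd z - snd (last q)) \<in> {(1, 1), (1, -1)}"
proof -
  have step: "(\<forall>j. Suc j < length (q @ [z]) \<longrightarrow> R ((q @ [z]) ! Suc j) ((q @ [z]) ! j)) \<longleftrightarrow>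
      (\<forall>j. Suc j < length q \<longrightarrow> R (q ! Suc j) (q ! j)) \<and> R z (last q)" for R
  proof -
    obtain k where k: "length q = Suc k"
      using assms by (cases q) auto
    then have "last q = q ! k"
      using assms by (simp add: last_conv_nth)
    with k show ?thesis
      by (auto simp: All_less_Suc nth_append)
  qed
  show ?thesis
    unfolding is_walk_def
    using step[of "\<lambda>a b. (fst a - fst b, snd a - snd b) \<in> {(1, 1), (1, -1)}"] assms
    by auto
qed

text \<open>Guarantees that a point added at time \<open>t + 1\<close> is new, which matters for
  viciousness and for counting contacts.\<close>

lemma runs_fst_le:
  assumes "runs_from_to p (0, b) (int t, h)" "r \<in> set p"
  shows "fst r \<le> int t"
proof -
  from assms have w: "is_walk p" and hl: "hd p = (0, b)" "last p = (int t, h)"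
    by (auto simp: runs_from_to_def)
  from assms(2) obtain j where j: "j < length p" "r = p ! j"
    by (auto simp: in_set_conv_nth)
  have "p \<noteq> []" using j by auto
  then have "int t = int (length p - 1)"
    using walk_fst_nth[OF w, of "length p - 1"] hl by (simp add: last_conv_nth)
  moreover have "fst r = int j"
    using walk_fst_nth[OF w j(1)] hl j by simp
  ultimately show ?thesis using j(1) by simp
qed

lemma runs_from_to_0:
  "runs_from_to p (0, b) (0, h) \<longleftrightarrow> p = [(0, b)] \<and> b = h \<and> 0 \<le> b"
proof
  assume r: "runs_from_to p (0, b) (0, h)"
  then have w: "is_walk p" and hl: "hd p = (0, b)" "last p = (0, h)"
    by (auto simp: runs_from_to_def)
  then have ne: "p \<noteq> []" by (simp add: is_walk_def)
  then have "int (length p - 1) = 0"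
    using walk_fst_nth[OF w, of "length p - 1"] hl by (simp add: last_conv_nth)
  with ne have "length p = 1" by (cases p) auto
  then obtain z where "p = [z]" by (auto simp: length_Suc_conv)
  with w hl show "p = [(0, b)] \<and> b = h \<and> 0 \<le> b"
    by (auto simp: is_walk_def)
qed (auto simp: runs_from_to_def is_walk_def)

lemma runs_from_to_nonneg: "runs_from_to p a b \<Longrightarrow> 0 \<le> snd b"
  unfolding runs_from_to_def is_walk_def using last_in_set by blast

lemma runs_from_to_last: "runs_from_to p a b \<Longrightarrow> b \<in> set p"
  unfolding runs_from_to_def is_walk_def using last_in_set by blast

lemma runs_from_to_snoc:
  assumes "runs_from_to q a (int t, h')" "h = h' + 1 \<or> h = h' - 1" "0 \<le> h"
  shows "runs_from_to (q @ [(int (Suc t), h)]) a (int (Suc t), h)"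
proof -
  have "q \<noteq> []" using assms(1) by (auto simp: runs_from_to_def is_walk_def)
  with assms show ?thesis
    by (auto simp: runs_from_to_def is_walk_snoc)
qed

lemma runs_from_to_butlast:
  assumes "runs_from_to p (0, b) (int (Suc t), h)"
  shows "p = butlast p @ [(int (Suc t), h)]" "0 \<le> h"
    "\<exists>h'. (h' = h - 1 \<or> h' = h + 1) \<and> runs_from_to (butlast p) (0, b) (int t, h')"
proof -
  from assms have ne: "p \<noteq> []" and l: "last p = (int (Suc t), h)"
    by (auto simp: runs_from_to_def is_walk_def)
  then show eq: "p = butlast p @ [(int (Suc t), h)]"
    by (metis append_butlast_last_id)
  show "0 \<le> h" using runs_from_to_nonneg[OF assms] by simp
  have "butlast p \<noteq> []"
  proof
    assume "butlast p = []"
    with eq have "p = [(int (Suc t), h)]" by simp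
    with assms show False by (simp add: runs_from_to_def)
  qed
  moreover define q where "q = butlast p"
  ultimately have "q \<noteq> []" "p = q @ [(int (Suc t), h)]" using eq by auto
  with assms have "is_walk q" "hd q = (0, b)"
    "(int (Suc t) - fst (last q), h - snd (last q)) \<in> {(1, 1), (1, -1)}"
    by (auto simp: runs_from_to_def is_walk_snoc)
  then have "runs_from_to q (0, b) (int t, snd (last q))"
    "snd (last q) = h - 1 \<or> snd (last q) = h + 1"
    by (auto simp: runs_from_to_def prod_eq_iff)
  then show "\<exists>h'. (h' = h - 1 \<or> h' = h + 1) \<and> runs_from_to (butlast p) (0, b) (int t, h')"
    unfolding q_def by blast
qed

text \<open>The end points alone give the contradiction. In the inductions a negative height arises
  only as \<open>-1\<close>, so the families disappear where \<open>star\<close> vanishes.\<close>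

lemma families_eq_empty:
  assumes "(\<exists>i<n. x i < 0) \<or> (\<exists>i j. i < n \<and> j < n \<and> i \<noteq> j \<and> x i = x j)"
  shows "families n t x = {}"
proof -
  have False if P: "P \<in> families n t x" for P
    using assms
  proof (elim disjE exE conjE)
    fix i assume "i < n" "x i < 0"
    with P show False
      using runs_from_to_nonneg[of "P ! i" "(0, 2 * int i)" "(int t, x i)"] by (auto simp: families_def)
  next
    fix i j assume ij: "i < n" "j < n" "i \<noteq> j" "x i = x j"
    with P have "(int t, x i) \<in> set (P ! i)" "(int t, x i) \<in> set (P ! j)"
      using runs_from_to_last by (fastforce simp: families_def)+
    moreover have "set (P ! i) \<inter> set (P ! j) = {}"
      using P ij by (auto simp: families_def vicious_def)
    ultimately show False by blast
  qed
  then show ?thesis by blast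
qed

definition append_points :: "nat \<Rightarrow> (nat \<Rightarrow> int) \<Rightarrow> point list list \<Rightarrow> point list list" where
  "append_points t x P = map (\<lambda>i. P ! i @ [(int t, x i)]) [0..<length P]"

lemma append_points_in_families:
  assumes P: "P \<in> families n t (moves S x)"
    and x: "\<And>i. i < n \<Longrightarrow> 0 \<le> x i" "inj_on x {..<n}"
  shows "append_points (Suc t) x P \<in> families n (Suc t) x"
proof -
  let ?P = "append_points (Suc t) x P"
  have len: "length P = n" "length ?P = n"
    using P by (auto simp: families_def append_points_def)
  have nth: "?P ! i = P ! i @ [(int (Suc t), x i)]" if "i < n" for i
    using that len by (simp add: append_points_def)
  have runs: "runs_from_to (P ! i) (0, 2 * int i) (int t, moves S x i)" if "i < n" for i
    using P that by (auto simp: families_def)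
  have new: "(int (Suc t), h) \<notin> set (P ! i)" if "i < n" for i h
    using runs_fst_le[OF runs[OF that], of "(int (Suc t), h)"] by auto
  have "set (?P ! i) \<inter> set (?P ! j) = {}" if "i < n" "j < n" "i \<noteq> j" for i j
  proof -
    have "set (P ! i) \<inter> set (P ! j) = {}"
      using P that by (auto simp: families_def vicious_def)
    moreover have "x i \<noteq> x j"
      using x(2) that by (auto dest: inj_onD)
    ultimately show ?thesis
      using new[OF that(1)] new[OF that(2)] that by (auto simp: nth)
  qed
  moreover have "runs_from_to (?P ! i) (0, 2 * int i) (int (Suc t), x i)" if "i < n" for i
    unfolding nth[OF that]
    by (rule runs_from_to_snoc[OF runs[OF that]]) (use x that in \<open>auto simp: moves_def\<close>)
  ultimately show ?thesis
    using len by (auto simp: families_def vicious_def)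
qed

lemma butlast_in_families:
  assumes P: "P \<in> families n (Suc t) x"
  defines "S \<equiv> {i. i < n \<and> snd (last (butlast (P ! i))) = x i - 1}"
  shows "map butlast P \<in> families n t (moves S x)" "append_points (Suc t) x (map butlast P) = P"
proof -
  have len: "length P = n" using P by (simp add: families_def)
  have runs: "runs_from_to (P ! i) (0, 2 * int i) (int (Suc t), x i)" if "i < n" for i
    using P that by (auto simp: families_def)
  have "runs_from_to (butlast (P ! i)) (0, 2 * int i) (int t, moves S x i)" if "i < n" for i
    using runs_from_to_butlast(3)[OF runs[OF that]] that
    by (auto simp: moves_def S_def runs_from_to_def)
  moreover have "vicious (map butlast P)"
    unfolding vicious_def
  proof (intro allI impI)
    fix i j assume "i < length (map butlast P)" "j < length (map butlast P)" "i \<noteq> j"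
    then have "set (P ! i) \<inter> set (P ! j) = {}"
      using P len by (auto simp: families_def vicious_def)
    then show "set (map butlast P ! i) \<inter> set (map butlast P ! j) = {}"
      using \<open>i < _\<close> \<open>j < _\<close> by (auto dest!: in_set_butlastD)
  qed
  ultimately show "map butlast P \<in> families n t (moves S x)"
    using len by (simp add: families_def)
  show "append_points (Suc t) x (map butlast P) = P"
    using len runs_from_to_butlast(1)[OF runs]
    by (intro nth_equalityI) (auto simp: append_points_def)
qed

text \<open>Removing all last points is a bijection onto pairs of a set \<open>S\<close> and a
  family ending at \<open>moves S x\<close>, where \<open>S\<close> is read off from the last but
  one heights. The general \<open>g\<close> serves for counting both families and contacts.\<close>

lemma sum_families_Suc:
  fixes g :: "point list list \<Rightarrow> real"
  assumes x: "\<And>i. i < n \<Longrightarrow> 0 \<le> x i" "inj_on x {..<n}"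
  shows "sum g (families n (Suc t) x) =
    (\<Sum>S\<in>Pow {..<n}. \<Sum>P\<in>families n t (moves S x). g (append_points (Suc t) x P))"
proof -
  let ?S = "\<lambda>P. {i. i < n \<and> snd (last (butlast (P ! i))) = x i - 1}"
  have "(\<Sum>S\<in>Pow {..<n}. \<Sum>P\<in>families n t (moves S x). g (append_points (Suc t) x P)) =
      (\<Sum>(S, P)\<in>(SIGMA S:Pow {..<n}. families n t (moves S x)). g (append_points (Suc t) x P))"
    by (rule sum.Sigma) (auto simp: finite_families)
  also have "\<dots> = sum g (families n (Suc t) x)"
  proof (rule sum.reindex_bij_witness[where i = "\<lambda>P. (?S P, map butlast P)"
        and j = "\<lambda>(S, P). append_points (Suc t) x P"], goal_cases)
    case (1 a)
    then obtain S P where a: "a = (S, P)" "S \<subseteq> {..<n}" "P \<in> families n t (moves S x)" by auto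
    then have len: "length P = n" by (simp add: families_def)
    have "map butlast (append_points (Suc t) x P) = P"
      by (intro nth_equalityI) (simp_all add: append_points_def)
    moreover have "?S (append_points (Suc t) x P) = S"
    proof (rule Set.set_eqI)
      fix i
      show "i \<in> ?S (append_points (Suc t) x P) \<longleftrightarrow> i \<in> S"
      proof (cases "i < n")
        case True
        then have "snd (last (P ! i)) = moves S x i"
          using a(3) by (auto simp: families_def runs_from_to_def)
        then show ?thesis
          using True len by (simp add: append_points_def moves_def)
      next
        case False
        then show ?thesis using a(2) by auto
      qed
    qed
    ultimately show ?case by (simp add: a)
  next
    case (2 a)
    then obtain S P where a: "a = (S, P)" "P \<in> families n t (moves S x)" by auto
    show ?case
      unfolding a(1) prod.case by (rule append_points_in_families[OF a(2) x])
  next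
    case (3 P)
    then show ?case using butlast_in_families(2)[OF 3] by simp
  next
    case (4 P)
    have "?S P \<in> Pow {..<n}" by blast
    then show ?case using butlast_in_families(1)[OF 4] by (rule SigmaI)
  next
    case (5 a)
    then show ?case by (simp add: case_prod_beta)
  qed
  finally show ?thesis ..
qed

text \<open>The only axis point at time \<open>t + 1\<close> is \<open>(t + 1, 0)\<close>, so the
  last step adds at most one contact, and that one is new.\<close>

lemma contacts_append_points:
  assumes "P \<in> families n t z"
  shows "contacts (append_points (Suc t) x P) = contacts P + (if \<exists>i<n. x i = 0 then 1 else 0)"
proof -
  let ?C = "\<lambda>P. {q. snd q = 0 \<and> (\<exists>p\<in>set P. q \<in> set p)} :: point set"
  have len: "length P = n" using assms by (simp add: families_def)
  have C: "?C Q = (\<Union>i<n. {q \<in> set (Q ! i). snd q = 0})" if "length Q = n" for Q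
    using that by (auto simp: set_conv_nth)
  have "length (append_points (Suc t) x P) = n"
    by (simp add: append_points_def len)
  then have "?C (append_points (Suc t) x P) =
      (\<Union>i<n. {q \<in> set (append_points (Suc t) x P ! i). snd q = 0})"
    by (rule C)
  also have "\<dots> = (\<Union>i<n. {q \<in> set (P ! i). snd q = 0} \<union> (if x i = 0 then {(int (Suc t), 0)} else {}))"
    by (intro SUP_cong refl) (auto simp: append_points_def len)
  also have "\<dots> = ?C P \<union> (if \<exists>i<n. x i = 0 then {(int (Suc t), 0)} else {})"
    unfolding C[OF len] UN_Un_distrib by auto
  finally have eq: "?C (append_points (Suc t) x P) =
      ?C P \<union> (if \<exists>i<n. x i = 0 then {(int (Suc t), 0)} else {})" .
  have "finite (?C P)"
    by (rule finite_subset[of _ "\<Union>(set ` set P)"]) auto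
  moreover have "(int (Suc t), 0) \<notin> ?C P"
  proof
    assume "(int (Suc t), 0) \<in> ?C P"
    then obtain i where "i < n" "(int (Suc t), 0) \<in> set (P ! i)"
      unfolding C[OF len] by blast
    with assms runs_fst_le[of "P ! i" "2 * int i" t "z i" "(int (Suc t), 0)"] show False
      by (auto simp: families_def)
  qed
  ultimately show ?thesis
    unfolding contacts_def eq by auto
qed

lemma families_0:
  "families n 0 x =
    (if \<forall>i<n. x i = 2 * int i then {map (\<lambda>i. [(0, 2 * int i)]) [0..<n]} else {})"
proof -
  have "P \<in> families n 0 x \<longleftrightarrow>
      (\<forall>i<n. x i = 2 * int i) \<and> P = map (\<lambda>i. [(0, 2 * int i)]) [0..<n]" for P
  proof
    assume "P \<in> families n 0 x"
    then have "length P = n" "\<forall>i<n. P ! i = [(0, 2 * int i)] \<and> 2 * int i = x i"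
      by (simp_all add: families_def runs_from_to_0)
    then show "(\<forall>i<n. x i = 2 * int i) \<and> P = map (\<lambda>i. [(0, 2 * int i)]) [0..<n]"
      by (simp add: list_eq_iff_nth_eq)
  next
    assume "(\<forall>i<n. x i = 2 * int i) \<and> P = map (\<lambda>i. [(0, 2 * int i)]) [0..<n]"
    then show "P \<in> families n 0 x"
      by (auto simp: families_def runs_from_to_0 vicious_def)
  qed
  then show ?thesis by auto
qed

lemma contacts_start:
  assumes "1 \<le> n"
  shows "contacts (map (\<lambda>i. [(0, 2 * int i)]) [0..<n]) = 1"
proof -
  have "{q. snd q = 0 \<and> (\<exists>p\<in>set (map (\<lambda>i. [(0, 2 * int i)]) [0..<n]). q \<in> set p)} = {(0::int, 0::int)}"
    using assms by (auto intro!: bexI[of _ 0])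
  then show ?thesis by (simp add: contacts_def)
qed

section \<open>Numbers of families and of contacts\<close>

text \<open>Parity is included because it forces neighbouring heights to differ by at least
  2.\<close>

definition chamber :: "nat \<Rightarrow> nat \<Rightarrow> (nat \<Rightarrow> int) \<Rightarrow> bool" where
  "chamber n t x \<longleftrightarrow> (\<forall>i<n. 0 \<le> x i \<and> even (int t + x i)) \<and> (\<forall>i. Suc i < n \<longrightarrow> x i < x (Suc i))"

lemma chamber_less:
  assumes "chamber n t x" "i < j" "j < n"
  shows "x i < x j"
  using assms(2,3)
proof (induction j)
  case (Suc j)
  then have "x j < x (Suc j)"
    using assms(1) by (simp add: chamber_def)
  with Suc show ?case
    by (cases "i = j") auto
qed simp

lemma chamber_inj: "chamber n t x \<Longrightarrow> inj_on x {..<n}"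
  by (rule linorder_inj_onI') (metis chamber_less lessThan_iff less_irrefl)

lemma chamber_gap:
  assumes "chamber n t x" "Suc i < n"
  shows "x i + 2 \<le> x (Suc i)"
proof -
  have "even (int t + x i)" "even (int t + x (Suc i))" "x i < x (Suc i)"
    using assms Suc_lessD[OF assms(2)] unfolding chamber_def by blast+
  then show ?thesis by presburger
qed

text \<open>A gap of at least 2 shrinks by at most 2, so neighbours may meet but not cross, and the
  axis is left only from height 0 to \<open>-1\<close>.\<close>

lemma moves_cases:
  assumes "chamber n (Suc t) x"
  obtains "chamber n t (moves S x)"
  | j where "j < n" "j \<in> S" "x j = 0"
  | i where "Suc i < n" "moves S x i = moves S x (Suc i)"
proof -
  have "chamber n t (moves S x)"
    if no_axis: "\<And>j. j < n \<Longrightarrow> j \<in> S \<Longrightarrow> x j \<noteq> 0"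
      and no_coincidence: "\<And>i. Suc i < n \<Longrightarrow> moves S x i \<noteq> moves S x (Suc i)"
    unfolding chamber_def
  proof (intro conjI allI impI)
    fix i assume i: "i < n"
    then have "0 \<le> x i" "even (int (Suc t) + x i)"
      using assms by (simp_all add: chamber_def)
    then show "0 \<le> moves S x i" "even (int t + moves S x i)"
      using no_axis[OF i] by (auto simp: moves_def)
  next
    fix i assume i: "Suc i < n"
    then have "moves S x i \<le> moves S x (Suc i)"
      using chamber_gap[OF assms i] by (simp add: moves_def)
    with no_coincidence[OF i] show "moves S x i < moves S x (Suc i)" by simp
  qed
  with that show ?thesis by blast
qed

abbreviation start :: "nat \<Rightarrow> int" where
  "start \<equiv> \<lambda>i. 2 * int i"

lemma chamber_ge_start:
  assumes "chamber n 0 x" "i < n"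
  shows "2 * int i \<le> x i"
  using assms(2)
proof (induction i)
  case 0
  then show ?case using assms(1) by (simp add: chamber_def)
next
  case (Suc i)
  with chamber_gap[OF assms(1), of i] show ?case by simp
qed

text \<open>At time 0 the weight of a height above \<open>2 * n - 2\<close> vanishes, which leaves only the
  starting heights.\<close>

lemma star_0_eq_0:
  assumes x: "chamber n 0 x" and ne: "\<exists>i<n. x i \<noteq> start i"
  shows "star n 0 x = 0"
proof -
  obtain i where i: "i < n" "x i \<noteq> 2 * int i" using ne by blast
  \<comment> \<open>A height above its starting value pushes up all later ones, so the excess
    reaches the last height.\<close>
  have grow: "2 * int (i + k) < x (i + k)" if "i + k < n" for k
    using that
  proof (induction k)
    case 0
    then show ?case using chamber_ge_start[OF x i(1)] i(2) by simp
  next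
    case (Suc k)
    with chamber_gap[OF x, of "i + k"] show ?case by simp
  qed
  define m where "m = n - 1"
  have m: "m < n" "int n = int m + 1" "2 * int m < x m"
    using grow[of "n - 1 - i"] i by (auto simp: m_def)
  then have "weight n 0 (x m) = 0"
    by (simp add: weight_def inv_fact_def)
  then have "(\<Prod>j<n. (of_int (x j) + 1) * weight n 0 (x j)) = 0"
    using m(1) by (intro prod_zero) (auto intro!: bexI[of _ m])
  then show ?thesis by (simp add: star_def)
qed

lemma moves_axis: "j \<in> S \<Longrightarrow> x j = 0 \<Longrightarrow> moves S x j = -1"
  by (simp add: moves_def)

lemma chamber_Suc_parity: "chamber n (Suc t) x \<Longrightarrow> j < n \<Longrightarrow> even (int t + x j + 1)"
  by (auto simp: chamber_def)

text \<open>Both sides obey the same recursion: by \<open>moves_cases\<close> the predecessors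
  outside the chamber admit no families and are zeros of \<open>star\<close>. The factor
  \<open>star n 0 start\<close> is the constant up to which \<open>star\<close> counts.\<close>

lemma card_families:
  assumes "chamber n t x"
  shows "real (card (families n t x)) * star n 0 start = star n t x"
  using assms
proof (induction t arbitrary: x)
  case 0
  show ?case
  proof (cases "\<forall>i<n. x i = start i")
    case True
    then have "star n 0 x = star n 0 start"
      unfolding star_def by (intro arg_cong2[where f = "(*)"] matrix_det_cong) auto
    then show ?thesis
      using True by (simp add: families_0)
  next
    case False
    then have "families n 0 x = {}" unfolding families_0 by (rule if_not_P)
    then show ?thesis
      using star_0_eq_0[OF "0.prems"] False by simp
  qed
next
  case (Suc t)
  have "real (card (families n (Suc t) x)) = (\<Sum>P\<in>families n (Suc t) x. 1)"
    by simp
  also have "\<dots> = (\<Sum>S\<in>Pow {..<n}. real (card (families n t (moves S x))))"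
    using Suc.prems by (subst sum_families_Suc) (auto simp: chamber_def intro: chamber_inj[OF Suc.prems])
  finally have "real (card (families n (Suc t) x)) * star n 0 start =
      (\<Sum>S\<in>Pow {..<n}. real (card (families n t (moves S x))) * star n 0 start)"
    by (simp add: sum_distrib_right)
  also have "\<dots> = (\<Sum>S\<in>Pow {..<n}. star n t (moves S x))"
  proof (rule sum.cong[OF refl])
    fix S
    from Suc.prems show "real (card (families n t (moves S x))) * star n 0 start = star n t (moves S x)"
    proof (cases rule: moves_cases[where S = S])
      case 1
      then show ?thesis by (rule Suc.IH)
    next
      case (2 j)
      then have "moves S x j = -1" by (simp add: moves_axis)
      with 2 have "families n t (moves S x) = {}" "star n t (moves S x) = 0"
        by (auto intro!: families_eq_empty exI[of _ j] star_eq_0_axis[of j])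
      then show ?thesis by simp
    next
      case (3 i)
      then have "families n t (moves S x) = {}"
        by (intro families_eq_empty disjI2 exI[of _ i] exI[of _ "Suc i"]) auto
      moreover have "star n t (moves S x) = 0"
        using 3 by (intro star_eq_0_coincide[of i n "Suc i"]) auto
      ultimately show ?thesis by simp
    qed
  qed
  also have "\<dots> = star n (Suc t) x"
    using chamber_Suc_parity[OF Suc.prems] by (rule star_Suc[symmetric])
  finally show ?case .
qed

section \<open>Recursion and boundary values of the raised sum\<close>

definition raised_star :: "nat \<Rightarrow> nat \<Rightarrow> (nat \<Rightarrow> int) \<Rightarrow> real" where
  "raised_star n t x = star n t x + (\<Sum>k<n. star n t (x(k := x k + 2)))"

text \<open>Raising a height by 2 commutes with \<open>moves\<close> and keeps the parity, so every
  summand obeys \<open>star_Suc\<close>.\<close>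

lemma raised_star_Suc:
  assumes "\<And>j. j < n \<Longrightarrow> even (int t + x j + 1)"
  shows "raised_star n (Suc t) x = (\<Sum>S\<in>Pow {..<n}. raised_star n t (moves S x))"
proof -
  have shift: "moves S (x(k := x k + 2)) = (moves S x)(k := moves S x k + 2)" for S k
    by (auto simp: moves_def)
  have "star n (Suc t) (x(k := x k + 2)) =
      (\<Sum>S\<in>Pow {..<n}. star n t ((moves S x)(k := moves S x k + 2)))" for k
    unfolding shift[symmetric] using assms by (intro star_Suc) auto
  then have "(\<Sum>k<n. star n (Suc t) (x(k := x k + 2))) =
      (\<Sum>k<n. \<Sum>S\<in>Pow {..<n}. star n t ((moves S x)(k := moves S x k + 2)))"
    by simp
  also have "\<dots> = (\<Sum>S\<in>Pow {..<n}. \<Sum>k<n. star n t ((moves S x)(k := moves S x k + 2)))"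
    by (rule sum.swap)
  finally show ?thesis
    using star_Suc[OF assms] by (simp add: raised_star_def sum.distrib)
qed

text \<open>Only raising one of the two equal heights removes the coincidence. The two results
  differ by a transposition, so they cancel by \<open>star_swap\<close>.\<close>

lemma raised_star_coincide:
  assumes i: "Suc i < n" and eq: "x i = x (Suc i)"
  shows "raised_star n t x = 0"
proof -
  have "star n t x = 0"
    using assms by (intro star_eq_0_coincide[of i n "Suc i"]) auto
  moreover have "star n t (x(k := x k + 2)) = 0" if "k \<notin> {i, Suc i}" for k
    using assms that by (intro star_eq_0_coincide[of i n "Suc i"]) auto
  then have "(\<Sum>k<n. star n t (x(k := x k + 2))) = (\<Sum>k\<in>{i, Suc i}. star n t (x(k := x k + 2)))"
    using i by (intro sum.mono_neutral_right) auto
  moreover have "x(Suc i := x (Suc i) + 2) = x(i := x i + 2) \<circ> Transposition.transpose i (Suc i)"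
    using eq by (auto simp: Transposition.transpose_def)
  then have "star n t (x(Suc i := x (Suc i) + 2)) = - star n t (x(i := x i + 2))"
    using star_swap[of i n "Suc i"] i by simp
  ultimately show ?thesis
    by (simp add: raised_star_def)
qed

lemma raised_star_axis:
  assumes "j < n" "x j = -1"
  shows "raised_star n t x = star n t (x(j := 1))"
proof -
  have "star n t (x(k := x k + 2)) = 0" if "k \<noteq> j" for k
    using assms that by (intro star_eq_0_axis[of j]) auto
  then have "(\<Sum>k<n. star n t (x(k := x k + 2))) = (\<Sum>k\<in>{j}. star n t (x(k := x k + 2)))"
    using assms by (intro sum.mono_neutral_right) auto
  then show ?thesis
    using assms star_eq_0_axis[of j n x t] by (simp add: raised_star_def)
qed

text \<open>A raised height either meets its neighbour or gives a point of the chamber other than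
  \<open>start\<close>; \<open>star\<close> vanishes in both cases. This fits the single contact at
  time 0.\<close>

lemma raised_star_0:
  assumes "chamber n 0 x"
  shows "raised_star n 0 x = star n 0 x"
proof -
  have "star n 0 (x(k := x k + 2)) = 0" if k: "k < n" for k
  proof (cases "Suc k < n \<and> x (Suc k) = x k + 2")
    case True
    then show ?thesis by (intro star_eq_0_coincide[of k n "Suc k"]) auto
  next
    case False
    have "chamber n 0 (x(k := x k + 2))"
      unfolding chamber_def
    proof (intro conjI allI impI)
      fix i assume "i < n"
      then show "0 \<le> (x(k := x k + 2)) i" "even (int 0 + (x(k := x k + 2)) i)"
        using assms by (auto simp: chamber_def)
    next
      fix i assume i: "Suc i < n"
      then show "(x(k := x k + 2)) i < (x(k := x k + 2)) (Suc i)"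
        using chamber_gap[OF assms i] False by auto
    qed
    moreover have "(x(k := x k + 2)) k \<noteq> start k"
      using chamber_ge_start[OF assms k] by simp
    ultimately show ?thesis
      using k star_0_eq_0 by blast
  qed
  then show ?thesis by (simp add: raised_star_def)
qed

text \<open>The left side sums the boundary values from \<open>raised_star_axis\<close>, with the
  step of walk \<open>j\<close> to \<open>-1\<close> replaced by one to 1. On the right, sets
  containing \<open>j\<close> contribute nothing.\<close>

lemma sum_moves_axis:
  assumes "j < n" "x j = 0"
  shows "(\<Sum>S\<in>Pow {..<n}. if j \<in> S then star n t (moves (S - {j}) x) else 0) =
    (\<Sum>S\<in>Pow {..<n}. star n t (moves S x))"
proof -
  have "(\<Sum>S\<in>Pow {..<n}. if j \<in> S then star n t (moves (S - {j}) x) else 0) =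
      (\<Sum>S\<in>{S \<in> Pow {..<n}. j \<in> S}. star n t (moves (S - {j}) x))"
    by (rule sum.inter_filter[symmetric]) simp
  also have "\<dots> = (\<Sum>S\<in>{S \<in> Pow {..<n}. j \<notin> S}. star n t (moves S x))"
    using assms(1)
    by (intro sum.reindex_bij_witness[where i = "insert j" and j = "\<lambda>S. S - {j}"]) auto
  also have "\<dots> = (\<Sum>S\<in>Pow {..<n}. star n t (moves S x))"
  proof (rule sum.mono_neutral_left)
    show "\<forall>S\<in>Pow {..<n} - {S \<in> Pow {..<n}. j \<notin> S}. star n t (moves S x) = 0"
      using assms by (auto intro!: star_eq_0_axis[of j] simp: moves_axis)
  qed auto
  finally show ?thesis .
qed

text \<open>The last step adds \<open>c\<close> contacts to every family, hence
  \<open>c * star n (Suc t) x\<close> in total; exactly this is supplied by the values of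
  \<open>raised_star\<close> on the axis.\<close>

lemma sum_contacts:
  assumes n: "1 \<le> n" and "chamber n t x"
  shows "(\<Sum>P\<in>families n t x. real (contacts P)) * star n 0 start = raised_star n t x"
  using assms(2)
proof (induction t arbitrary: x)
  case 0
  have "real (contacts P) = 1" if "P \<in> families n 0 x" for P
    using that contacts_start[OF n] unfolding families_0 by (auto split: if_splits)
  then have "(\<Sum>P\<in>families n 0 x. real (contacts P)) = real (card (families n 0 x))"
    by simp
  then show ?case
    using card_families[OF "0.prems"] raised_star_0[OF "0.prems"] by simp
next
  case (Suc t)
  define K where "K = star n 0 start"
  define A where "A = (\<lambda>z. \<Sum>P\<in>families n t z. real (contacts P))"
  define c where "c = (if \<exists>i<n. x i = 0 then 1 else 0 :: real)"
  have parity: "\<And>j. j < n \<Longrightarrow> even (int t + x j + 1)"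
    using chamber_Suc_parity[OF Suc.prems] .
  have x: "\<And>i. i < n \<Longrightarrow> 0 \<le> x i" "inj_on x {..<n}"
    using Suc.prems chamber_inj[OF Suc.prems] by (auto simp: chamber_def)
  have "(\<Sum>P\<in>families n (Suc t) x. real (contacts P)) =
      (\<Sum>S\<in>Pow {..<n}. \<Sum>P\<in>families n t (moves S x). real (contacts (append_points (Suc t) x P)))"
    by (rule sum_families_Suc[OF x])
  also have "\<dots> = (\<Sum>S\<in>Pow {..<n}. \<Sum>P\<in>families n t (moves S x). real (contacts P) + c)"
  proof (intro sum.cong refl)
    fix S P assume "P \<in> families n t (moves S x)"
    from contacts_append_points[OF this, of x]
    show "real (contacts (append_points (Suc t) x P)) = real (contacts P) + c"
      by (simp add: c_def)
  qed
  also have "\<dots> = (\<Sum>S\<in>Pow {..<n}. A (moves S x)) +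
      c * (\<Sum>S\<in>Pow {..<n}. \<Sum>P\<in>families n t (moves S x). 1)"
    by (simp add: sum.distrib A_def sum_distrib_left mult.commute)
  also have "(\<Sum>S\<in>Pow {..<n}. \<Sum>P\<in>families n t (moves S x). 1) = real (card (families n (Suc t) x))"
    using sum_families_Suc[OF x, of "\<lambda>_. 1" t] by simp
  finally have "(\<Sum>P\<in>families n (Suc t) x. real (contacts P)) * K =
      (\<Sum>S\<in>Pow {..<n}. A (moves S x) * K) + c * star n (Suc t) x"
    using card_families[OF Suc.prems] by (simp add: K_def distrib_right sum_distrib_right mult.assoc)
  also have "\<dots> = (\<Sum>S\<in>Pow {..<n}. raised_star n t (moves S x))"
  proof -
    have inner: "A (moves S x) * K = raised_star n t (moves S x)"
      if no_axis: "\<And>j. j < n \<Longrightarrow> j \<in> S \<Longrightarrow> x j \<noteq> 0" for S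
      using Suc.prems
    proof (cases rule: moves_cases[where S = S])
      case 1
      then show ?thesis unfolding A_def K_def by (rule Suc.IH)
    next
      case (2 j)
      with no_axis show ?thesis by blast
    next
      case (3 i)
      then have "families n t (moves S x) = {}"
        by (intro families_eq_empty disjI2 exI[of _ i] exI[of _ "Suc i"]) auto
      then show ?thesis
        using raised_star_coincide[of i n "moves S x" t] 3 by (simp add: A_def)
    qed
    show ?thesis
    proof (cases "\<exists>j<n. x j = 0")
      case False
      then have "c = 0" unfolding c_def by (rule if_not_P)
      then show ?thesis using inner False by simp
    next
      case True
      then obtain j where j: "j < n" "x j = 0" by blast
      \<comment> \<open>Only one height can be 0, so for \<open>j \<notin> S\<close> no walk leaves
        the axis downwards and \<open>inner\<close> applies.\<close>
      have unique: "i = j" if "i < n" "x i = 0" for i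
        using inj_onD[OF x(2), of i j] that j by simp
      have "raised_star n t (moves S x) =
          A (moves S x) * K + (if j \<in> S then star n t (moves (S - {j}) x) else 0)" for S
      proof (cases "j \<in> S")
        case True
        with j have m: "moves S x j = -1" by (simp add: moves_axis)
        then have "families n t (moves S x) = {}"
          using j by (auto intro!: families_eq_empty exI[of _ j])
        moreover have "(moves S x)(j := 1) = moves (S - {j}) x"
          using j by (auto simp: moves_def)
        ultimately show ?thesis
          using raised_star_axis[OF j(1), of "moves S x"] m True by (simp add: A_def)
      next
        case False
        then have "\<And>i. i < n \<Longrightarrow> i \<in> S \<Longrightarrow> x i \<noteq> 0" using unique by blast
        from inner[OF this] False show ?thesis by simp
      qed
      then have "(\<Sum>S\<in>Pow {..<n}. raised_star n t (moves S x)) =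
          (\<Sum>S\<in>Pow {..<n}. A (moves S x) * K) + star n (Suc t) x"
        using sum_moves_axis[of j n x t] j star_Suc[OF parity] by (simp add: sum.distrib)
      then show ?thesis using True by (simp add: c_def)
    qed
  qed
  also have "\<dots> = raised_star n (Suc t) x"
    using parity by (rule raised_star_Suc[symmetric])
  finally show ?case by (simp add: K_def)
qed

section \<open>Effect of raising the last of equally spaced heights\<close>

lemma weight_add_2:
  assumes "even (int t + x)"
  shows "(real t + of_int x + 2 * real n + 2) * weight n t (x + 2) =
    (real t - of_int x + 2 * real n - 2) * weight n t x"
proof -
  obtain k where "int t + x = 2 * k" using assms by blast
  then have x: "x = 2 * k - int t" by simp
  define a b where "a = k + int n + 1" and "b = int t - k + int n - 1"
  have "(int t + (x + 2)) div 2 + int n = a" "(int t + x) div 2 + int n = a - 1"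
    "(int t - (x + 2)) div 2 + int n - 1 = b - 1" "(int t - x) div 2 + int n - 1 = b"
    by (simp_all add: x a_def b_def)
  then have "weight n t (x + 2) = inv_fact a * inv_fact (b - 1)"
    "weight n t x = inv_fact (a - 1) * inv_fact b"
    by (simp_all add: weight_def)
  moreover have "real t + of_int x + 2 * real n + 2 = 2 * of_int a"
    "real t - of_int x + 2 * real n - 2 = 2 * of_int b"
    by (simp_all add: x a_def b_def)
  ultimately show ?thesis
    by (simp add: inv_fact_pred)
qed

lemma weight_pos:
  assumes "1 \<le> n" "\<bar>x\<bar> \<le> int t + 2 * int n - 2"
  shows "weight n t x > 0"
proof -
  have "0 \<le> (int t + x) div 2 + int n" "0 \<le> (int t - x) div 2 + int n - 1"
    using assms by linarith+
  then show ?thesis by (simp add: weight_def inv_fact_def)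
qed

lemma star_pos:
  assumes "1 \<le> n" "chamber n t x" "\<And>i. i < n \<Longrightarrow> x i \<le> int t + 2 * int n - 2"
  shows "star n t x > 0"
proof -
  have nonneg: "0 \<le> x j" if "j < n" for j
    using assms(2) that by (simp add: chamber_def)
  have "0 < (\<Prod>j<n. (real_of_int (x j) + 1) * weight n t (x j))"
    using assms nonneg by (intro prod_pos ballI mult_pos_pos weight_pos) fastforce+
  moreover have "0 < (\<Prod>j<n. \<Prod>i<j. (real_of_int (x j) + 1)\<^sup>2 - (real_of_int (x i) + 1)\<^sup>2)"
  proof (intro prod_pos ballI)
    fix j i assume "j \<in> {..<n}" "i \<in> {..<j}"
    then have "0 \<le> x i" "x i < x j"
      using chamber_less[OF assms(2), of i j] nonneg[of i] by auto
    then show "0 < (real_of_int (x j) + 1)\<^sup>2 - (real_of_int (x i) + 1)\<^sup>2"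
      by (simp add: power_strict_mono)
  qed
  ultimately show ?thesis
    unfolding star_def vandermonde by (intro mult_pos_pos norm_const_pos)
qed

lemma prod_telescope:
  fixes f :: "nat \<Rightarrow> 'a::comm_monoid_mult"
  shows "f 0 * (\<Prod>i<m. f (Suc i)) = f m * (\<Prod>i<m. f i)"
  by (metis mult.commute prod.lessThan_Suc prod.lessThan_Suc_shift o_def)

text \<open>As \<open>u\<close> is an arithmetic progression with difference 2, each difference of
  squares splits into 4 times a value of \<open>a\<close> and one of \<open>b\<close>. Raising
  \<open>u m\<close> by 2 only shifts the indices, so the quotient telescopes.\<close>

lemma raised_vandermonde_factor:
  fixes y :: real
  defines "u \<equiv> \<lambda>i. y + 2 * real i + 1"
  shows "(y + real m + 1) * (\<Prod>i<m. (u m + 2)\<^sup>2 - (u i)\<^sup>2) =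
    (real m + 1) * u m * (\<Prod>i<m. (u m)\<^sup>2 - (u i)\<^sup>2)"
proof -
  define a where "a = (\<lambda>i. real m + 1 - real i)"
  define b where "b = (\<lambda>i. y + real m + 1 + real i)"
  have "(\<Prod>i<m. (u m + 2)\<^sup>2 - (u i)\<^sup>2) = (\<Prod>i<m. 4 * a i * b (Suc i))"
    by (intro prod.cong refl) (simp add: u_def a_def b_def power2_eq_square algebra_simps)
  also have "\<dots> = (\<Prod>i<m. 4) * (\<Prod>i<m. a i) * (\<Prod>i<m. b (Suc i))"
    by (simp only: prod.distrib)
  \<comment> \<open>Here \<open>b 0 = y + real m + 1\<close>, and \<open>a m = 1\<close> is inserted
    to make the second product telescope.\<close>
  finally have "(y + real m + 1) * (\<Prod>i<m. (u m + 2)\<^sup>2 - (u i)\<^sup>2) =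
      (\<Prod>i<m. 4) * (a m * (\<Prod>i<m. a i)) * (b 0 * (\<Prod>i<m. b (Suc i)))"
    by (simp add: a_def b_def)
  also have "\<dots> = a 0 * b m * ((\<Prod>i<m. 4) * (\<Prod>i<m. a (Suc i)) * (\<Prod>i<m. b i))"
    unfolding prod_telescope[of b] prod_telescope[of a, symmetric] by (simp only: mult_ac)
  also have "(\<Prod>i<m. 4) * (\<Prod>i<m. a (Suc i)) * (\<Prod>i<m. b i) = (\<Prod>i<m. 4 * a (Suc i) * b i)"
    by (simp only: prod.distrib)
  also have "\<dots> = (\<Prod>i<m. (u m)\<^sup>2 - (u i)\<^sup>2)"
    by (intro prod.cong refl) (simp add: u_def a_def b_def power2_eq_square algebra_simps)
  finally show ?thesis
    by (simp add: u_def a_def b_def algebra_simps)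
qed

lemma star_raise_last:
  assumes n: "n = Suc m" and x: "\<And>i. i < n \<Longrightarrow> x i = int y + 2 * int i" and "even (t + y)"
  shows "(real y + real n) * (real t + real y + 4 * real n) * star n t (x(m := x m + 2)) =
    real n * (real y + 2 * real n + 1) * (real t - real y) * star n t x"
proof -
  define w where "w = weight n t (x m)"
  define w' where "w' = weight n t (x m + 2)"
  define u where "u = (\<lambda>i. real y + 2 * real i + 1)"
  \<comment> \<open>All factors that do not involve the last height.\<close>
  define c where "c = norm_const n t * (\<Prod>j<m. u j * weight n t (x j)) * (\<Prod>j<m. \<Prod>i<j. (u j)\<^sup>2 - (u i)\<^sup>2)"
  define v where "v = (\<Prod>i<m. (u m)\<^sup>2 - (u i)\<^sup>2)"
  define v' where "v' = (\<Prod>i<m. (u m + 2)\<^sup>2 - (u i)\<^sup>2)"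
  have u: "real_of_int (x i) + 1 = u i" if "i < n" for i
    using x[OF that] by (simp add: u_def)
  have um: "real_of_int (x m) = u m - 1"
    using u[of m] n by simp
  have s: "star n t x = c * (u m * w * v)"
    unfolding star_def vandermonde by (simp add: n u c_def v_def w_def)
  have s': "star n t (x(m := x m + 2)) = c * ((u m + 2) * w' * v')"
    using um unfolding star_def vandermonde by (simp add: n u c_def v'_def w'_def add.commute[of 2])
  have "even (int t + x m)"
    using x[of m] n assms(3) by simp
  then have w: "(real t + real y + 4 * real n) * w' = (real t - real y) * w"
    using weight_add_2[of t "x m" n] x[of m] n by (simp add: w_def w'_def algebra_simps)
  have v: "(real y + real n) * v' = real n * u m * v"
    using raised_vandermonde_factor[of "real y" m] n by (simp add: u_def v_def v'_def algebra_simps)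
  have "(real y + real n) * (real t + real y + 4 * real n) * star n t (x(m := x m + 2)) =
      c * (u m + 2) * ((real t + real y + 4 * real n) * w') * ((real y + real n) * v')"
    unfolding s' by (simp add: mult_ac)
  also have "\<dots> = real n * (u m + 2) * (real t - real y) * (c * (u m * w * v))"
    unfolding w v by (simp add: mult_ac)
  also have "u m + 2 = real y + 2 * real n + 1"
    by (simp add: u_def n)
  finally show ?thesis unfolding s .
qed

text \<open>At 1 every power equals 1 and its derivative is the exponent, so the mean is the plain
  average over the families.\<close>

lemma mean_contacts_1:
  "mean_contacts n t y 1 =
     (\<Sum>P\<in>vicious_families n t y. real (contacts P)) / real (card (vicious_families n t y))"
proof -
  have "(Z n t y has_real_derivative (\<Sum>P\<in>vicious_families n t y. real (contacts P))) (at 1)"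
    unfolding Z_def[abs_def] by (auto intro!: derivative_eq_intros sum.cong)
  then have "deriv (Z n t y) 1 = (\<Sum>P\<in>vicious_families n t y. real (contacts P))"
    by (rule DERIV_imp_deriv)
  then show ?thesis
    by (simp add: mean_contacts_def Z_def)
qed

theorem theorem13:
  fixes n t y :: nat
  assumes "1 \<le> n" and "y \<le> t" and "t mod 2 = y mod 2"
  shows "mean_contacts n t y 1 =
    1 + real n * (real y + 2 * real n + 1) * (real t - real y) /
        ((real y + real n) * (real t + real y + 4 * real n))"
proof -
  define x where "x = (\<lambda>i. int y + 2 * int i)"
  obtain m where n: "n = Suc m" using assms(1) by (cases n) auto
  have even: "even (t + y)"
    using assms(3) by presburger
  have ch: "chamber n t x"
    using even by (auto simp: chamber_def x_def)
  have pos: "star n t x > 0"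
    using assms by (intro star_pos[OF assms(1) ch]) (auto simp: x_def)
  \<comment> \<open>Lets the common constant cancel between the total of contacts and the number of
    families.\<close>
  have pos0: "star n 0 start > 0"
    using assms(1) by (intro star_pos) (auto simp: chamber_def)
  \<comment> \<open>Raising any height but the last makes it coincide with the next one.\<close>
  have "star n t (x(k := x k + 2)) = 0" if "k < m" for k
    using that n by (intro star_eq_0_coincide[of k n "Suc k"]) (auto simp: x_def)
  then have "raised_star n t x = star n t x + star n t (x(m := x m + 2))"
    by (simp add: raised_star_def n)
  moreover have "vicious_families n t y = families n t x"
    by (simp add: vicious_families_def families_def x_def)
  then have "mean_contacts n t y 1 = raised_star n t x / star n t x"
    using card_families[OF ch] sum_contacts[OF assms(1) ch] pos0
    by (simp add: mean_contacts_1 flip: card_families[OF ch] sum_contacts[OF assms(1) ch])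
  ultimately have "mean_contacts n t y 1 = 1 + star n t (x(m := x m + 2)) / star n t x"
    using pos by (simp add: field_simps)
  also have "star n t (x(m := x m + 2)) / star n t x =
      real n * (real y + 2 * real n + 1) * (real t - real y) /
        ((real y + real n) * (real t + real y + 4 * real n))"
  proof -
    have "(real y + real n) * (real t + real y + 4 * real n) \<noteq> 0"
      using assms(1) by simp
    moreover have "(real y + real n) * (real t + real y + 4 * real n) * star n t (x(m := x m + 2)) =
        real n * (real y + 2 * real n + 1) * (real t - real y) * star n t x"
      by (rule star_raise_last[OF n _ even]) (simp add: x_def)
    ultimately show ?thesis
      using pos by (simp add: frac_eq_eq mult.commute)
  qed
  finally show ?thesis .
qed

end
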